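(* Let $q$ be a prime power, $m\geq 2$, and let $\rho, t$ be positive integers with $\rho\leq m$. Put $k=\rho t$. Then the $\mathbb{F}_q$-subspace of $\mathbb{F}_{q^m}^{k}$ \[U:=\{(x_1,x_1^q,\ldots,x_1^{q^{\rho-1}},x_2,x_2^q,\ldots,x_2^{q^{\rho-1}},\ldots,x_{t-1},x_{t-1}^q,\ldots,x_{t-1}^{q^{\rho-1}},a_1,a_2,\ldots,a_\rho)^T: x_i\in\mathbb{F}_{q^m}, a_j\in\mathbb{F}_q\}\] is a rank $\rho$-saturating system. Therefore \[s_{q^m/q}(\rho t,\rho)= m(t-1)+\rho.\]
   Context: For an $\mathbb{F}_q$-subspace $U$ of $V=\mathbb{F}_{q^m}^k$, the $\mathbb{F}_q$-linear set associated to $U$ is $L_U=\{\langle u\rangle_{\mathbb{F}_{q^m}} : u\in U\setminus\{0\}\}\subseteq \mathrm{PG}(k-1,q^m)$; its rank is $\dim_{\mathbb{F}_q}U$. For $\mathcal S\subseteq \mathrm{PG}(k-1,q^m)$, a point $Q$ is $(\rho-1)$-saturated by $\mathcal S$ if there are $\rho$ points $P_1,\dots,P_\rho\in\mathcal S$ with $Q\in\langle P_1,\dots,P_\rho\rangle_{\mathbb{F}_{q^m}}$; $\mathcal S$ is a $(\rho-1)$-saturating set if every point of $\mathrm{PG}(k-1,q^m)$ is $(\rho-1)$-saturated by $\mathcal S$ and $\rho$ is the smallest value with this property. An $\mathbb{F}_q$-subspace $U$ of $\mathbb{F}_{q^m}^k$ is a rank $\rho$-saturating system if $L_U$ is a $(\rho-1)$-saturating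 set. For $\rho\leq\min\{k,m\}$, $s_{q^m/q}(k,\rho)$ denotes the minimal $\mathbb{F}_q$-dimension of a rank $\rho$-saturating system in $\mathbb{F}_{q^m}^k$. *)

theory Defs
  imports Complex_Main "HOL-Library.Function_Algebras" "HOL-Library.Cardinality"
begin

text \<open>
  The extension of finite fields is given by two finite field types \<open>'f\<close> (with \<open>q\<close> elements) and
  \<open>'e\<close> (with \<open>q ^ m\<close> elements) together with an embedding of \<open>'f\<close> into \<open>'e\<close>.
\<close>

definition field_embedding :: "('f::field \<Rightarrow> 'e::field) \<Rightarrow> bool" where
  "field_embedding emb \<longleftrightarrow>
     emb 1 = 1 \<and> (\<forall>x y. emb (x + y) = emb x + emb y) \<and> (\<forall>x y. emb (x * y) = emb x * emb y)"

text \<open>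
  Since the dimension \<open>k\<close> has to vary, vectors of length \<open>k\<close> over \<open>'e\<close> are functions on the natural
  numbers vanishing outside \<open>{..<k}\<close>. These functions are a vector space over \<open>'e\<close> and, by
  restriction of scalars along the embedding, over \<open>'f\<close>.
\<close>

definition scale_ext :: "'e::field \<Rightarrow> (nat \<Rightarrow> 'e) \<Rightarrow> (nat \<Rightarrow> 'e)" where
  "scale_ext c v = (\<lambda>i. c * v i)"

definition scale_base :: "('f::field \<Rightarrow> 'e::field) \<Rightarrow> 'f \<Rightarrow> (nat \<Rightarrow> 'e) \<Rightarrow> (nat \<Rightarrow> 'e)" where
  "scale_base emb c v = scale_ext (emb c) v"

lemma vector_space_scale_ext: "vector_space (scale_ext :: 'e::field \<Rightarrow> _)"
  by unfold_locales (auto simp: scale_ext_def fun_eq_iff algebra_simps)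

lemma vector_space_scale_base:
  assumes "field_embedding emb"
  shows "vector_space (scale_base emb)"
  using assms
  by unfold_locales
    (auto simp: field_embedding_def scale_base_def scale_ext_def fun_eq_iff algebra_simps)

definition coord_space :: "nat \<Rightarrow> (nat \<Rightarrow> 'e::field) set" where
  "coord_space k = {v. \<forall>i\<ge>k. v i = 0}"

text \<open>The points of \<open>PG(k - 1, 'e)\<close> are the one-dimensional subspaces of \<open>coord_space k\<close>.\<close>

definition pg_points :: "nat \<Rightarrow> (nat \<Rightarrow> 'e::field) set set" where
  "pg_points k = {P. module.subspace scale_ext P \<and> P \<subseteq> coord_space k \<and>
                     vector_space.dim scale_ext P = 1}"

definition linear_set :: "(nat \<Rightarrow> 'e::field) set \<Rightarrow> (nat \<Rightarrow> 'e) set set" where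
  "linear_set U = {module.span scale_ext {u} | u. u \<in> U - {0}}"

text \<open>
  In the following three definitions \<open>r\<close> is the number of spanning points, so \<open>saturated r\<close> is
  \<open>(r - 1)\<close>-saturation and \<open>saturating_set k r\<close> means \<open>(r - 1)\<close>-saturating. The points
  \<open>P 0, \<dots>, P (r - 1)\<close> need not be distinct.
\<close>

definition saturated :: "nat \<Rightarrow> (nat \<Rightarrow> 'e::field) set set \<Rightarrow> (nat \<Rightarrow> 'e) set \<Rightarrow> bool" where
  "saturated r S Q \<longleftrightarrow>
     (\<exists>P :: nat \<Rightarrow> (nat \<Rightarrow> 'e) set. (\<forall>i<r. P i \<in> S) \<and> Q \<subseteq> module.span scale_ext (\<Union>i<r. P i))"

definition saturates_all :: "nat \<Rightarrow> nat \<Rightarrow> (nat \<Rightarrow> 'e::field) set set \<Rightarrow> bool" where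
  "saturates_all k r S \<longleftrightarrow> (\<forall>Q\<in>pg_points k. saturated r S Q)"

definition saturating_set :: "nat \<Rightarrow> nat \<Rightarrow> (nat \<Rightarrow> 'e::field) set set \<Rightarrow> bool" where
  "saturating_set k r S \<longleftrightarrow>
     S \<subseteq> pg_points k \<and> saturates_all k r S \<and> (\<forall>r'<r. \<not> saturates_all k r' S)"

definition saturating_system ::
    "('f::field \<Rightarrow> 'e::field) \<Rightarrow> nat \<Rightarrow> nat \<Rightarrow> (nat \<Rightarrow> 'e) set \<Rightarrow> bool" where
  "saturating_system emb k r U \<longleftrightarrow>
     U \<subseteq> coord_space k \<and> module.subspace (scale_base emb) U \<and> saturating_set k r (linear_set U)"

text \<open>\<open>min_saturating_dim emb k r\<close> is $s_{q^m/q}(k,r)$.\<close>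

definition min_saturating_dim :: "('f::field \<Rightarrow> 'e::field) \<Rightarrow> nat \<Rightarrow> nat \<Rightarrow> nat" where
  "min_saturating_dim emb k r =
     (LEAST d. \<exists>U. saturating_system emb k r U \<and> vector_space.dim (scale_base emb) U = d)"

text \<open>
  The subspace of all vectors consisting of \<open>t - 1\<close> blocks \<open>(x, x ^ q, \<dots>, x ^ q ^ (r - 1))\<close>,
  where \<open>x\<close> depends on the block, followed by one block of \<open>r\<close> entries from the base field. In the
  \<open>n\<close>-th coordinate, \<open>n div r\<close> is the number of the block (counted from 0) and \<open>n mod r\<close> the
  position within it.
\<close>

definition frobenius_system ::
    "('f::{field,finite} \<Rightarrow> 'e::field) \<Rightarrow> nat \<Rightarrow> nat \<Rightarrow> (nat \<Rightarrow> 'e) set" where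
  "frobenius_system emb r t =
     {(\<lambda>n. if n < r * (t - 1) then x (n div r) ^ (CARD('f) ^ (n mod r))
           else if n < r * t then emb (a (n mod r))
           else 0) | (x :: nat \<Rightarrow> 'e) (a :: nat \<Rightarrow> 'f). True}"

end

theory Submission
  imports Defs "HOL-Library.FuncSet" "HOL-Computational_Algebra.Polynomial"
begin

text \<open>
  Write $v = (v^{(1)}, \dots, v^{(t)})$ in blocks of length $\rho$. The entries of the last block lie
  in the span over the base field of some independent $\lambda_1, \dots, \lambda_\rho$. With these as
  coefficients, the first $t - 1$ blocks lead to systems
  $\sum_i \lambda_i x_i^{q^j} = v_j$ for $0 \le j < \rho$. They are solvable because a solution of the
  homogeneous system would, after raising the $j$-th equation to the power $q^{\rho - 1 - j}$, be a
  relation between the columns of the Moore matrix of the $\lambda_i$. Fewer than $\rho$ points do not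
  suffice if the last block is independent over the base field.

  For the lower bound, count the pairs of $\lambda \neq 0$ in $\mathbb{F}_{q^m}^\rho$ and $w \in U^\rho$,
  where $d = \dim U$. Every vector of $\mathbb{F}_{q^m}^{\rho t}$ is of the form $\sum_i \lambda_i w_i$, and
  this for at least $q^{\rho(\rho - 1)}$ pairs, since $\lambda$ may be replaced by any other basis of
  the same $\rho$-dimensional space. So $q^{m \rho t + \rho(\rho - 1)} < q^{m \rho + d \rho}$,
  that is, $d \ge m (t - 1) + \rho$.
\<close>

section \<open>The Frobenius map of a finite field extension\<close>

text \<open>Multiplication by \<open>x \<noteq> 0\<close> permutes the nonzero elements. Comparing
  their product before and after gives \<open>x ^ (CARD('a) - 1) = 1\<close>.\<close>

lemma power_card_eq_self:
  fixes x :: "'a :: {field,finite}"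
  shows "x ^ CARD('a) = x"
proof (cases "x = 0")
  case True
  then show ?thesis by (simp add: power_0_left)
next
  case False
  let ?S = "UNIV - {0 :: 'a}"
  have "\<Prod>?S = (\<Prod>y\<in>?S. x * y)"
    by (rule prod.reindex_bij_witness[of _ "\<lambda>y. x * y" "\<lambda>y. y / x"]) (use False in auto)
  also have "\<dots> = x ^ card ?S * \<Prod>?S"
    by (simp add: prod.distrib)
  finally have "x ^ (CARD('a) - 1) = 1"
    by (simp add: card_Diff_singleton)
  then have "x * x ^ (CARD('a) - 1) = x" by simp
  then show ?thesis
    by (metis power_eq_if[of x "CARD('a)"] finite card_eq_0_iff UNIV_not_empty)
qed

text \<open>
  The polynomial $(X + 1)^q - X^q - 1$ has degree less than $q$ and all $q$ field elements are roots.
  This avoids showing that $q$ is a power of the characteristic.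
\<close>

lemma of_nat_card_choose_eq_0:
  assumes "0 < i" "i < CARD('a :: {field,finite})"
  shows "(of_nat (CARD('a) choose i) :: 'a) = 0"
proof -
  let ?q = "CARD('a)"
  let ?P = "(\<Sum>k\<in>{1..<?q}. monom (of_nat (?q choose k)) k) :: 'a poly"
  have coeff: "coeff ?P j = (if j \<in> {1..<?q} then of_nat (?q choose j) else 0)" for j
    by (simp add: coeff_sum)
  have root: "poly ?P a = 0" for a
  proof -
    have "a + 1 = (a + 1) ^ ?q" by (simp add: power_card_eq_self)
    also have "\<dots> = (\<Sum>k\<le>?q. of_nat (?q choose k) * a ^ k)"
      by (simp add: binomial_ring)
    also have "{..?q} = insert 0 (insert ?q {1..<?q})" using assms by auto
    also have "(\<Sum>k\<in>\<dots>. of_nat (?q choose k) * a ^ k) = 1 + a + poly ?P a"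
      using assms by (simp add: poly_sum poly_monom power_card_eq_self)
    finally show ?thesis by simp
  qed
  have "?P = 0"
  proof (rule ccontr)
    assume "?P \<noteq> 0"
    then have "card {a. poly ?P a = 0} \<le> degree ?P" by (rule card_poly_roots_bound)
    moreover have "degree ?P \<le> ?q - 1"
      by (rule degree_le, intro allI impI, subst coeff) auto
    ultimately show False using root assms by simp
  qed
  then have "coeff ?P i = 0" by simp
  then show ?thesis using assms coeff[of i] by simp
qed

section \<open>The embedding of the base field and the powers of the Frobenius map\<close>

locale finite_field_extension =
  fixes emb :: "'f::{field,finite} \<Rightarrow> 'e::{field,finite}"
  assumes field_embedding: "field_embedding emb"
begin

lemma emb_1 [simp]: "emb 1 = 1"
  and emb_add [simp]: "emb (x + y) = emb x + emb y"
  and emb_mult [simp]: "emb (x * y) = emb x * emb y"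
  using field_embedding by (auto simp: field_embedding_def)

lemma emb_0 [simp]: "emb 0 = 0"
proof -
  have "emb 0 + emb 0 = emb 0 + 0" using emb_add[of 0 0] by simp
  then show ?thesis by (rule add_left_imp_eq)
qed

lemma emb_minus [simp]: "emb (- x) = - emb x"
  using emb_add[of x "- x"] by (simp add: eq_neg_iff_add_eq_0 add.commute)

lemma emb_diff [simp]: "emb (x - y) = emb x - emb y"
  using emb_add[of x "- y"] by simp

lemma emb_eq_0_iff [simp]: "emb x = 0 \<longleftrightarrow> x = 0"
proof
  assume "emb x = 0"
  then have "emb (x * inverse x) = 0" by (simp del: right_inverse)
  then show "x = 0" by (cases "x = 0") auto
qed simp

lemma emb_eq_iff [simp]: "emb x = emb y \<longleftrightarrow> x = y"
  using emb_eq_0_iff[of "x - y"] by (simp del: emb_eq_0_iff)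

lemma emb_sum: "emb (sum f A) = (\<Sum>x\<in>A. emb (f x))"
  by (induction A rule: infinite_finite_induct) auto

lemma emb_power: "emb (x ^ n) = emb x ^ n"
  by (induction n) auto

lemma emb_of_nat: "emb (of_nat n) = of_nat n"
  by (induction n) auto

lemma card_base_ge_2: "CARD('f) \<ge> 2"
proof -
  have "card {0, 1 :: 'f} \<le> CARD('f)" by (rule card_mono) auto
  then show ?thesis by simp
qed

lemma frobenius_add: "(x + y :: 'e) ^ (CARD('f) ^ j) = x ^ (CARD('f) ^ j) + y ^ (CARD('f) ^ j)"
proof (induction j)
  case (Suc j)
  have *: "(x + y :: 'e) ^ CARD('f) = x ^ CARD('f) + y ^ CARD('f)" for x y
  proof -
    \<comment> \<open>The binomial coefficients vanish in \<open>'f\<close>, whose cardinality is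
      the exponent; \<open>emb\<close> carries this over to \<open>'e\<close>.\<close>
    have "(of_nat (CARD('f) choose i) :: 'e) = 0" if "i \<in> {1..<CARD('f)}" for i
      using of_nat_card_choose_eq_0[where ?'a = 'f, of i] that
      by (metis atLeastLessThan_iff emb_0 emb_of_nat less_eq_Suc_le One_nat_def)
    then have "(\<Sum>i\<in>{1..<CARD('f)}. of_nat (CARD('f) choose i) * x ^ i * y ^ (CARD('f) - i)) = 0"
      by (intro sum.neutral) simp
    moreover have "{..CARD('f)} = insert 0 (insert (CARD('f)) {1..<CARD('f)})" by auto
    ultimately show ?thesis using card_base_ge_2 by (simp add: binomial_ring)
  qed
  show ?case by (simp add: power_mult Suc * mult.commute[of "CARD('f)"])
qed simp

lemma frobenius_sum: "(\<Sum>i\<in>A. f i :: 'e) ^ (CARD('f) ^ j) = (\<Sum>i\<in>A. f i ^ (CARD('f) ^ j))"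
  by (induction A rule: infinite_finite_induct) (auto simp: frobenius_add power_0_left)

lemma frobenius_emb [simp]: "emb c ^ (CARD('f) ^ j) = emb c"
proof (induction j)
  case (Suc j)
  have "emb c ^ (CARD('f) ^ Suc j) = (emb c ^ (CARD('f) ^ j)) ^ CARD('f)"
    by (simp add: power_mult[symmetric] mult.commute)
  also have "\<dots> = emb c" by (simp only: Suc) (simp add: power_card_eq_self flip: emb_power)
  finally show ?case .
qed simp

lemma frobenius_diff: "(x - y :: 'e) ^ (CARD('f) ^ j) = x ^ (CARD('f) ^ j) - y ^ (CARD('f) ^ j)"
  using frobenius_add[of "x - y" y j] by simp

text \<open>The q images under \<open>emb\<close> are roots of X^q - X, and this polynomial has at
  most q roots.\<close>

lemma frobenius_fixed_imp_range:
  assumes "x ^ CARD('f) = x"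
  shows "x \<in> range emb"
proof -
  let ?P = "monom 1 (CARD('f)) - monom 1 1 :: 'e poly"
  have coeff: "coeff ?P (CARD('f)) = 1" using card_base_ge_2 by simp
  then have "?P \<noteq> 0" by (metis coeff_0 zero_neq_one)
  then have "card {a. poly ?P a = 0} \<le> degree ?P" by (rule card_poly_roots_bound)
  also have "degree ?P \<le> CARD('f)"
    by (rule degree_le) (use card_base_ge_2 in auto)
  also have "CARD('f) = card (range emb)" by (simp add: card_image inj_on_def)
  finally have le: "card {a. poly ?P a = 0} \<le> card (range emb)" .
  have "range emb \<subseteq> {a. poly ?P a = 0}"
    using frobenius_emb[of _ 1] by (auto simp: poly_monom)
  then have "range emb = {a. poly ?P a = 0}"
    by (rule card_seteq[rotated]) (use le in auto)
  then show ?thesis using assms by (auto simp: poly_monom)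
qed

section \<open>Families independent over the base field\<close>

text \<open>Here \<open>'e\<close> is regarded as a vector space over \<open>'f\<close>. Families
  are functions of which only the values below \<open>n\<close> count, so that bases can later be
  counted as ordered tuples.\<close>

definition base_span :: "nat \<Rightarrow> (nat \<Rightarrow> 'e) \<Rightarrow> 'e set" where
  "base_span n l = range (\<lambda>c. \<Sum>i<n. emb (c i) * l i)"

definition base_independent :: "nat \<Rightarrow> (nat \<Rightarrow> 'e) \<Rightarrow> bool" where
  "base_independent n l \<longleftrightarrow> (\<forall>c. (\<Sum>i<n. emb (c i) * l i) = 0 \<longrightarrow> (\<forall>i<n. c i = 0))"

lemma base_span_cong: "(\<And>i. i < n \<Longrightarrow> l i = l' i) \<Longrightarrow> base_span n l = base_span n l'"
  by (simp add: base_span_def)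

lemma base_independent_cong:
  "(\<And>i. i < n \<Longrightarrow> l i = l' i) \<Longrightarrow> base_independent n l = base_independent n l'"
  by (simp add: base_independent_def)

lemma base_independentD:
  "base_independent n l \<Longrightarrow> (\<Sum>i<n. emb (c i) * l i) = 0 \<Longrightarrow> i < n \<Longrightarrow> c i = 0"
  by (simp add: base_independent_def)

lemma base_spanE:
  assumes "x \<in> base_span n l"
  obtains c where "x = (\<Sum>i<n. emb (c i) * l i)"
  using assms by (auto simp: base_span_def)

lemma base_span_lincomb:
  assumes "\<And>j. j < p \<Longrightarrow> w j \<in> base_span n l"
  shows "(\<Sum>j<p. emb (c j) * w j) \<in> base_span n l"
proof -
  have "\<exists>d. \<forall>j<p. w j = (\<Sum>i<n. emb (d j i) * l i)"
    using assms unfolding base_span_def by (simp add: image_iff) metis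
  then obtain d where d: "\<And>j. j < p \<Longrightarrow> w j = (\<Sum>i<n. emb (d j i) * l i)" by auto
  have "(\<Sum>j<p. emb (c j) * w j) = (\<Sum>j<p. \<Sum>i<n. emb (c j * d j i) * l i)"
    by (simp add: d sum_distrib_left mult.assoc)
  also have "\<dots> = (\<Sum>i<n. emb (\<Sum>j<p. c j * d j i) * l i)"
    by (subst sum.swap) (simp add: emb_sum sum_distrib_right)
  finally show ?thesis by (auto simp: base_span_def)
qed

lemma base_span_mono:
  assumes "\<And>j. j < p \<Longrightarrow> w j \<in> base_span n l"
  shows "base_span p w \<subseteq> base_span n l"
  using base_span_lincomb[OF assms] by (auto elim!: base_spanE)

lemma base_span_base:
  assumes "i < n"
  shows "l i \<in> base_span n l"
proof -
  have "l i = (\<Sum>j<n. emb (if j = i then 1 else 0) * l j)"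
    using assms by (simp add: if_distrib[of emb] if_distrib[of "\<lambda>x. x * _"] cong: if_cong)
  then show ?thesis unfolding base_span_def
    by (rule range_eqI[of _ _ "\<lambda>j. if j = i then 1 else 0"])
qed

text \<open>Extensional coefficient functions form a set of size \<open>CARD('f) ^ n\<close>, which
  makes spans countable.\<close>

lemma base_span_image: "base_span n l = (\<lambda>c. \<Sum>i<n. emb (c i) * l i) ` ({..<n} \<rightarrow>\<^sub>E UNIV)"
proof -
  have "(\<Sum>i<n. emb (c i) * l i) \<in> (\<lambda>c. \<Sum>i<n. emb (c i) * l i) ` ({..<n} \<rightarrow>\<^sub>E UNIV)" for c
    by (rule image_eqI[of _ _ "restrict c {..<n}"]) simp_all
  then show ?thesis unfolding base_span_def by blast
qed

lemma card_base_span_le: "card (base_span n l) \<le> CARD('f) ^ n"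
  unfolding base_span_image
  by (rule order_trans[OF card_image_le]) (auto simp: card_PiE finite_PiE)

lemma card_base_span_eq:
  assumes "base_independent n l"
  shows "card (base_span n l) = CARD('f) ^ n"
proof -
  have "inj_on (\<lambda>c. \<Sum>i<n. emb (c i) * l i) ({..<n} \<rightarrow>\<^sub>E UNIV)"
  proof (rule inj_onI)
    fix c c' assume c: "c \<in> {..<n} \<rightarrow>\<^sub>E UNIV" "c' \<in> {..<n} \<rightarrow>\<^sub>E UNIV"
      and "(\<Sum>i<n. emb (c i) * l i) = (\<Sum>i<n. emb (c' i) * l i)"
    then have "(\<Sum>i<n. emb (c i - c' i) * l i) = 0"
      by (simp add: left_diff_distrib sum_subtractf)
    then have "\<forall>i<n. c i - c' i = 0"
      using base_independentD[OF assms, of "\<lambda>i. c i - c' i"] by blast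
    then show "c = c'" using c by (intro PiE_ext[of _ "{..<n}"]) auto
  qed
  then show ?thesis unfolding base_span_image by (simp add: card_image card_PiE)
qed

lemma base_independent_Suc:
  assumes "base_independent n l" "l n \<notin> base_span n l"
  shows "base_independent (Suc n) l"
  unfolding base_independent_def
proof (intro allI impI)
  fix c i assume 0: "(\<Sum>i<Suc n. emb (c i) * l i) = 0" and i: "i < Suc n"
  have cn: "c n = 0"
  proof (rule ccontr)
    assume n: "c n \<noteq> 0"
    have "(\<Sum>i<n. emb (- (c i / c n)) * l i) = emb (- (1 / c n)) * (\<Sum>i<n. emb (c i) * l i)"
      by (simp add: sum_distrib_left sum_negf flip: mult.assoc emb_mult)
    also have "(\<Sum>i<n. emb (c i) * l i) = - emb (c n) * l n"
      using 0 by (simp add: eq_neg_iff_add_eq_0)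
    also have "emb (- (1 / c n)) * (- emb (c n) * l n) = emb (1 / c n * c n) * l n"
      by (simp only: emb_mult emb_minus) simp
    also have "\<dots> = l n" using n by simp
    finally have "l n = (\<Sum>i<n. emb (- (c i / c n)) * l i)" by (rule sym)
    then have "l n \<in> base_span n l"
      unfolding base_span_def by (rule range_eqI[of _ _ "\<lambda>i. - (c i / c n)"])
    then show False using assms(2) by simp
  qed
  then show "c i = 0" using 0 assms(1) i by (auto simp: base_independent_def less_Suc_eq)
qed

lemma base_independent_SucD: "base_independent (Suc n) l \<Longrightarrow> base_independent n l"
  unfolding base_independent_def
proof (intro allI impI)
  fix c i assume *: "\<forall>c. (\<Sum>i<Suc n. emb (c i) * l i) = 0 \<longrightarrow> (\<forall>i<Suc n. c i = 0)"
    and 0: "(\<Sum>i<n. emb (c i) * l i) = 0" and i: "i < n"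
  from 0 have "(\<Sum>i<Suc n. emb ((c(n := 0)) i) * l i) = 0" by simp
  with * have "\<forall>i<Suc n. (c(n := 0)) i = 0" by blast
  then show "c i = 0" using i by (metis fun_upd_other less_SucI less_irrefl_nat)
qed

text \<open>A family of length \<open>j < m\<close> spans at most q^j < q^m elements, so a vector
  outside its span is always available.\<close>

lemma base_independent_extend:
  assumes "CARD('e) = CARD('f) ^ m" "n \<le> p" "p \<le> m" "base_independent n l"
  shows "\<exists>l'. base_independent p l' \<and> (\<forall>i<n. l' i = l i)"
  using assms(2,3)
proof (induction rule: dec_induct)
  case base
  then show ?case using assms(4) by blast
next
  case (step j)
  then obtain l' where l': "base_independent j l'" "\<forall>i<n. l' i = l i" by auto
  have "card (base_span j l') < CARD('e)"
    using card_base_span_le[of j l'] assms(1) step card_base_ge_2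
    by (simp add: order_le_less_trans power_strict_increasing)
  then obtain x where x: "x \<notin> base_span j l'" by (metis UNIV_eq_I less_irrefl)
  have "base_independent (Suc j) (l'(j := x))"
    using x l'(1) base_span_cong[of j l' "l'(j := x)"] base_independent_cong[of j l' "l'(j := x)"]
    by (intro base_independent_Suc) auto
  moreover have "\<forall>i<n. (l'(j := x)) i = l i" using l'(2) step(1) by simp
  ultimately show ?case by blast
qed

text \<open>An independent part of the \<open>w i\<close> with the same span is selected greedily.
  It may be shorter than \<open>p\<close> and is then filled up to length exactly \<open>p\<close>,
  for which \<open>p \<le> m\<close> leaves room.\<close>

lemma exists_base_independent_spanning:
  assumes "CARD('e) = CARD('f) ^ m" "p \<le> m"
  shows "\<exists>l. base_independent p l \<and> (\<forall>i<p. w i \<in> base_span p l)"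
proof -
  have "\<exists>j\<le>n. \<exists>l. base_independent j l \<and> (\<forall>i<n. w i \<in> base_span j l)" for n
  proof (induction n)
    case 0
    have "base_independent 0 l" for l by (simp add: base_independent_def)
    then show ?case by auto
  next
    case (Suc n)
    then obtain j l where j: "j \<le> n" "base_independent j l" "\<forall>i<n. w i \<in> base_span j l" by auto
    show ?case
    proof (cases "w n \<in> base_span j l")
      case True
      then show ?thesis using j by (intro exI[of _ j]) (auto simp: less_Suc_eq)
    next
      case False
      let ?l = "l(j := w n)"
      have "base_independent (Suc j) ?l"
        using False j(2) base_span_cong[of j l ?l] base_independent_cong[of j l ?l]
        by (intro base_independent_Suc) auto
      moreover have "base_span j l \<subseteq> base_span (Suc j) ?l"
        by (rule base_span_mono) (metis base_span_base fun_upd_other less_SucI less_irrefl_nat)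
      moreover have "w n \<in> base_span (Suc j) ?l"
        by (metis base_span_base fun_upd_same lessI)
      ultimately show ?thesis using j by (intro exI[of _ "Suc j"]) (auto simp: less_Suc_eq)
    qed
  qed
  then obtain j l where j: "j \<le> p" "base_independent j l" "\<forall>i<p. w i \<in> base_span j l" by blast
  then obtain l' where l': "base_independent p l'" "\<forall>i<j. l' i = l i"
    using base_independent_extend[OF assms(1) j(1) assms(2) j(2)] by auto
  have "base_span j l \<subseteq> base_span p l'"
    by (rule base_span_mono) (metis base_span_base j(1) l'(2) order_less_le_trans)
  then show ?thesis using l'(1) j(3) by blast
qed

text \<open>The vectors are chosen one at a time. After \<open>j < n\<close> choices at most q^j
  \<le> q^(n-1) elements are forbidden, and q \<ge> 2 gives q^n - q^(n-1) \<ge> q^(n-1), so at least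
  q^(n-1) choices remain.\<close>

lemma card_base_independent_ge:
  assumes "card W \<ge> CARD('f) ^ n" "j \<le> n"
  shows "card {l \<in> {..<j} \<rightarrow>\<^sub>E W. base_independent j l} \<ge> CARD('f) ^ ((n - 1) * j)"
  using assms(2)
proof (induction j)
  case 0
  have "base_independent 0 l" for l by (simp add: base_independent_def)
  then have "{l \<in> {..<0} \<rightarrow>\<^sub>E W. base_independent 0 l} = {\<lambda>_. undefined}" by auto
  then show ?case by simp
next
  case (Suc j)
  let ?A = "\<lambda>j. {l \<in> {..<j} \<rightarrow>\<^sub>E W. base_independent j l}"
  \<comment> \<open>Pairs of an independent \<open>j\<close>-tuple and an admissible next vector;
    appending the vector is injective.\<close>
  let ?S = "SIGMA l:?A j. W - base_span j l"
  let ?f = "\<lambda>(l, x). l(j := x)"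
  have fin: "finite (?A i)" for i 
    by (rule finite_subset[of _ "{..<i} \<rightarrow>\<^sub>E W"]) (auto simp: finite_PiE)
  have "inj_on ?f ?S"
  proof (rule inj_onI)
    fix s s' assume s: "s \<in> ?S" "s' \<in> ?S" "?f s = ?f s'"
    obtain l x l' x' where ss: "s = (l, x)" "s' = (l', x')" by (cases s, cases s')
    have l: "l \<in> {..<j} \<rightarrow>\<^sub>E W" "l' \<in> {..<j} \<rightarrow>\<^sub>E W" and eq: "l(j := x) = l'(j := x')"
      using s by (simp_all add: ss)
    from eq have "x = x'" by (metis fun_upd_same)
    moreover from eq have "l i = l' i" if "i < j" for i
      by (metis fun_upd_other less_irrefl_nat that)
    then have "l = l'" using l by (intro PiE_ext[of _ "{..<j}"]) auto
    ultimately show "s = s'" by (simp add: ss)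
  qed
  moreover have "?f ` ?S \<subseteq> ?A (Suc j)"
  proof (rule image_subsetI)
    fix s assume s: "s \<in> ?S"
    obtain l x where ss: "s = (l, x)" by (cases s)
    have l: "l \<in> {..<j} \<rightarrow>\<^sub>E W" "base_independent j l" "x \<in> W" "x \<notin> base_span j l"
      using s by (simp_all add: ss)
    have "base_independent (Suc j) (l(j := x))"
      using l base_span_cong[of j l "l(j := x)"] base_independent_cong[of j l "l(j := x)"]
      by (intro base_independent_Suc) auto
    moreover have "l(j := x) \<in> {..<Suc j} \<rightarrow>\<^sub>E W"
      using l by (auto simp: PiE_def Pi_def extensional_def less_Suc_eq)
    ultimately show "?f s \<in> ?A (Suc j)" by (simp add: ss)
  qed
  ultimately have le: "card ?S \<le> card (?A (Suc j))" by (rule card_inj_on_le) (rule fin)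
  have 1: "CARD('f) ^ (n - 1) \<le> card (W - base_span j l)" for l
  proof -
    have "CARD('f) ^ (n - 1) + CARD('f) ^ j \<le> 2 * CARD('f) ^ (n - 1)"
      using Suc.prems card_base_ge_2 by (simp add: power_increasing)
    also have "\<dots> \<le> CARD('f) * CARD('f) ^ (n - 1)" using card_base_ge_2 by simp
    also have "\<dots> = CARD('f) ^ n" using Suc.prems by (simp flip: power_Suc)
    finally have "CARD('f) ^ (n - 1) \<le> card W - card (base_span j l)"
      using assms(1) card_base_span_le[of j l] by linarith
    then show ?thesis using diff_card_le_card_Diff[of "base_span j l" W] by simp
  qed
  have "CARD('f) ^ ((n - 1) * Suc j) = CARD('f) ^ ((n - 1) * j) * CARD('f) ^ (n - 1)"
    by (simp add: power_add)
  also have "\<dots> \<le> card (?A j) * CARD('f) ^ (n - 1)"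
    using Suc by simp
  also have "\<dots> = (\<Sum>l\<in>?A j. CARD('f) ^ (n - 1))" by simp
  also have "\<dots> \<le> (\<Sum>l\<in>?A j. card (W - base_span j l))" by (rule sum_mono) (rule 1)
  also have "\<dots> = card ?S" using fin by simp
  finally show ?case using le by linarith
qed

section \<open>Moore systems\<close>

text \<open>
  Subtracting the Frobenius image of a relation with last coefficient 1 from the relation itself
  gives a shorter relation, so in a minimal one all coefficients are Frobenius-fixed.
\<close>

lemma moore_kernel_trivial:
  assumes "base_independent n l"
    and "\<And>j. j < n \<Longrightarrow> (\<Sum>i<n. y i * l i ^ (CARD('f) ^ (s + j))) = 0"
  shows "\<forall>i<n. y i = 0"
  using assms
proof (induction n arbitrary: y s)
  case (Suc n)
  let ?q = "CARD('f)"
  have ind: "base_independent n l" using Suc.prems(1) by (rule base_independent_SucD)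
  show ?case
  proof (cases "y n = 0")
    case True
    have "\<forall>i<n. y i = 0"
      by (rule Suc.IH[OF ind, of _ s]) (use Suc.prems(2) True in fastforce)
    then show ?thesis using True by (auto simp: less_Suc_eq)
  next
    case False
    define z where "z i = y i / y n" for i
    have zn: "z n = 1" using False by (simp add: z_def)
    have z0: "(\<Sum>i<Suc n. z i * l i ^ (?q ^ (s + j))) = 0" if "j < Suc n" for j
      using Suc.prems(2)[OF that] by (simp add: z_def flip: sum_divide_distrib add_divide_distrib)
    \<comment> \<open>The Frobenius map takes equation \<open>s + j\<close> to exponent
      \<open>Suc s + j\<close>, which is also the exponent of the original equation with index
      \<open>Suc j\<close>. Subtracting the two leaves \<open>n\<close> equations starting at
      \<open>Suc s\<close>; this is why the induction runs over arbitrary \<open>s\<close>.\<close>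
    have "\<forall>i<n. z i ^ ?q - z i = 0"
    proof (rule Suc.IH[OF ind, of _ "Suc s"])
      fix j assume j: "j < n"
      have "(\<Sum>i<Suc n. z i ^ ?q * l i ^ (?q ^ (Suc s + j))) = (\<Sum>i<Suc n. z i * l i ^ (?q ^ (s + j))) ^ (?q ^ 1)"
        unfolding frobenius_sum
        by (intro sum.cong refl) (simp add: power_mult_distrib mult.commute flip: power_mult)
      also have "\<dots> = 0" using z0[of j] j by (simp add: power_0_left)
      finally have "(\<Sum>i<Suc n. z i ^ ?q * l i ^ (?q ^ (Suc s + j))) - (\<Sum>i<Suc n. z i * l i ^ (?q ^ (s + Suc j))) = 0"
        using z0[of "Suc j"] j by simp
      then show "(\<Sum>i<n. (z i ^ ?q - z i) * l i ^ (?q ^ (Suc s + j))) = 0"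
        by (simp add: zn left_diff_distrib sum_subtractf)
    qed
    then have "\<forall>i<Suc n. z i \<in> range emb"
      using zn by (auto simp: less_Suc_eq intro: frobenius_fixed_imp_range range_eqI[of _ _ 1])
    then have "\<exists>c. \<forall>i<Suc n. z i = emb (c i)" by (simp add: image_iff) metis
    then obtain c where c: "\<And>i. i < Suc n \<Longrightarrow> z i = emb (c i)" by blast
    \<comment> \<open>Frobenius-fixed coefficients allow a q^s-th root of the equation with
      \<open>j = 0\<close> to be taken. The result is a relation over the base field, contradicting
      \<open>z n = 1\<close>.\<close>
    have "(\<Sum>i<Suc n. emb (c i) * l i) ^ (?q ^ s) = (\<Sum>i<Suc n. z i * l i ^ (?q ^ (s + 0)))"
      unfolding frobenius_sum by (intro sum.cong) (auto simp: c power_mult_distrib)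
    also have "\<dots> = 0" by (rule z0) simp
    finally have "(\<Sum>i<Suc n. emb (c i) * l i) = 0" by (metis power_eq_0_iff)
    then have "c n = 0" using Suc.prems(1) unfolding base_independent_def by blast
    then show ?thesis using zn c[of n] by simp
  qed
qed simp

text \<open>The left-hand sides define a self-map of the finite set of \<open>n\<close>-tuples, so
  its surjectivity follows from injectivity.\<close>

lemma frobenius_system_solvable:
  assumes "base_independent n l"
  shows "\<exists>x. \<forall>j<n. (\<Sum>i<n. l i * x i ^ (CARD('f) ^ j)) = v j"
proof -
  let ?D = "{..<n} \<rightarrow>\<^sub>E (UNIV :: 'e set)"
  let ?T = "\<lambda>x. restrict (\<lambda>j. \<Sum>i<n. l i * x i ^ (CARD('f) ^ j)) {..<n}"
  have "inj_on ?T ?D"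
  proof (rule inj_onI)
    fix x x' assume x: "x \<in> ?D" "x' \<in> ?D" and eq: "?T x = ?T x'"
    \<comment> \<open>Raising the equation of index \<open>n - 1 - j\<close> to the power q^j gives
      every difference the exponent q^(n-1), whatever \<open>j\<close> is. These powers are then the
      coefficients in a Moore system with \<open>s = 0\<close>.\<close>
    have "(\<Sum>i<n. (x i - x' i) ^ (CARD('f) ^ (n - 1)) * l i ^ (CARD('f) ^ (0 + j))) = 0"
      if j: "j < n" for j
    proof -
      have "?T x (n - 1 - j) = ?T x' (n - 1 - j)" by (simp only: eq)
      then have "(\<Sum>i<n. l i * (x i - x' i) ^ (CARD('f) ^ (n - 1 - j))) = 0"
        using j by (simp add: frobenius_diff right_diff_distrib sum_subtractf)
      then have "(\<Sum>i<n. l i * (x i - x' i) ^ (CARD('f) ^ (n - 1 - j))) ^ (CARD('f) ^ j) = 0"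
        by (simp add: power_0_left)
      then have "(\<Sum>i<n. l i ^ (CARD('f) ^ j) * (x i - x' i) ^ (CARD('f) ^ (n - 1 - j + j))) = 0"
        by (simp only: frobenius_sum power_mult_distrib power_add flip: power_mult)
      then show ?thesis using j by (simp add: mult.commute)
    qed
    from moore_kernel_trivial[OF assms this] have "\<forall>i<n. x i = x' i"
      by simp
    then show "x = x'" using x by (intro PiE_ext[of _ "{..<n}"]) auto
  qed
  then have "?T ` ?D = ?D"
    by (rule endo_inj_surj[rotated 2]) (simp_all add: finite_PiE image_subset_iff)
  moreover have "restrict v {..<n} \<in> ?D" by simp
  ultimately have "restrict v {..<n} \<in> ?T ` ?D" by (simp only:)
  then obtain x where x: "restrict v {..<n} = ?T x" by (rule imageE)
  have "(\<Sum>i<n. l i * x i ^ (CARD('f) ^ j)) = v j" if "j < n" for j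
    using fun_cong[OF x, of j] that by simp
  then show ?thesis by blast
qed

end

section \<open>Saturation by linear combinations\<close>

text \<open>This provides the passage between dimensions and cardinalities.\<close>

lemma (in vector_space) card_span_eq:
  assumes "finite B" "independent B"
  shows "card (span B) = CARD('a) ^ card B"
proof -
  let ?f = "\<lambda>u. \<Sum>v\<in>B. scale (u v) v"
  have "span B = ?f ` (B \<rightarrow>\<^sub>E UNIV)"
  proof -
    have "?f u \<in> ?f ` (B \<rightarrow>\<^sub>E UNIV)" for u
      by (rule image_eqI[of _ _ "restrict u B"]) (auto intro!: sum.cong)
    then show ?thesis using span_finite[OF assms(1)] by auto
  qed
  moreover have "inj_on ?f (B \<rightarrow>\<^sub>E UNIV)"
  proof (rule inj_onI)
    fix u u' assume u: "u \<in> B \<rightarrow>\<^sub>E UNIV" "u' \<in> B \<rightarrow>\<^sub>E UNIV" and "?f u = ?f u'"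
    then have "(\<Sum>v\<in>B. scale (u v - u' v) v) = 0"
      by (simp add: scale_left_diff_distrib sum_subtractf)
    then have "u v - u' v = 0" if "v \<in> B" for v
      using independentD[OF assms(2,1) order_refl, of "\<lambda>v. u v - u' v" v] that by simp
    then show "u = u'" using u by (intro PiE_ext[of _ B]) auto
  qed
  ultimately show ?thesis
    using assms(1) by (simp add: card_image card_PiE)
qed

interpretation ext: vector_space "scale_ext :: 'e::field \<Rightarrow> _"
  by (rule vector_space_scale_ext)

lemma sum_fun_apply: "(\<Sum>i\<in>A. f i) n = (\<Sum>i\<in>A. f i n)"
  by (induction A rule: infinite_finite_induct) auto

text \<open>Saturation expressed by vectors instead of points. The \<open>u i\<close> may be zero,
  although zero represents no point.\<close>

definition combination_of :: "nat \<Rightarrow> (nat \<Rightarrow> 'e::field) set \<Rightarrow> (nat \<Rightarrow> 'e) \<Rightarrow> bool" where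
  "combination_of r U v \<longleftrightarrow> (\<exists>c u. (\<forall>i<r. u i \<in> U) \<and> v = (\<lambda>n. \<Sum>i<r. c i * u i n))"

lemma ext_span_points:
  fixes r :: nat
  shows "v \<in> ext.span (\<Union>i<r. ext.span {u i}) \<longleftrightarrow> (\<exists>c. v = (\<lambda>n. \<Sum>i<r. c i * u i n))"
proof
  let ?A = "{v. \<exists>c. v = (\<lambda>n. \<Sum>i<r. c i * u i n)}"
  have sub: "ext.subspace ?A"
  proof (rule ext.subspaceI)
    show "0 \<in> ?A" by (auto simp: fun_eq_iff intro!: exI[of _ "\<lambda>_. 0"])
  next
    fix x y assume "x \<in> ?A" "y \<in> ?A"
    then obtain c d where "x = (\<lambda>n. \<Sum>i<r. c i * u i n)" "y = (\<lambda>n. \<Sum>i<r. d i * u i n)" by blast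
    then have "x + y = (\<lambda>n. \<Sum>i<r. (c i + d i) * u i n)"
      by (simp add: fun_eq_iff distrib_right sum.distrib)
    then show "x + y \<in> ?A" by (auto intro!: exI[of _ "\<lambda>i. c i + d i"])
  next
    fix a x assume "x \<in> ?A"
    then obtain c where "x = (\<lambda>n. \<Sum>i<r. c i * u i n)" by blast
    then have "scale_ext a x = (\<lambda>n. \<Sum>i<r. (a * c i) * u i n)"
      by (simp add: scale_ext_def sum_distrib_left mult.assoc)
    then show "scale_ext a x \<in> ?A" by (auto intro!: exI[of _ "\<lambda>i. a * c i"])
  qed
  have "u i \<in> ?A" if "i < r" for i
  proof -
    have "(\<Sum>j<r. (if j = i then 1 else 0) * u j n) = (\<Sum>j<r. if j = i then u j n else 0)" for n
      by (rule sum.cong) auto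
    then have "u i = (\<lambda>n. \<Sum>j<r. (if j = i then 1 else 0) * u j n)"
      using that by (simp add: fun_eq_iff)
    then show ?thesis by (intro CollectI exI[of _ "\<lambda>j. if j = i then 1 else 0"])
  qed
  then have "(\<Union>i<r. ext.span {u i}) \<subseteq> ?A"
    by (intro UN_least ext.span_minimal sub) auto
  then have "ext.span (\<Union>i<r. ext.span {u i}) \<subseteq> ?A" by (rule ext.span_minimal) (rule sub)
  then show "v \<in> ext.span (\<Union>i<r. ext.span {u i}) \<Longrightarrow> \<exists>c. v = (\<lambda>n. \<Sum>i<r. c i * u i n)" by blast
next
  assume "\<exists>c. v = (\<lambda>n. \<Sum>i<r. c i * u i n)"
  then obtain c where "v = (\<lambda>n. \<Sum>i<r. c i * u i n)" by blast
  then have v: "v = (\<Sum>i<r. scale_ext (c i) (u i))"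
    by (simp add: fun_eq_iff sum_fun_apply scale_ext_def)
  have "u i \<in> (\<Union>i<r. ext.span {u i})" if "i < r" for i
    using that ext.span_base[of "u i" "{u i}"] by blast
  then show "v \<in> ext.span (\<Union>i<r. ext.span {u i})"
    unfolding v by (intro ext.span_sum ext.span_scale ext.span_base) auto
qed

lemma ext_subspace_coord_space: "ext.subspace (coord_space k)"
  by (rule ext.subspaceI) (auto simp: coord_space_def scale_ext_def)

text \<open>With all points written as a linear set, a statement about points becomes one about
  nonzero vectors, and linear sets can be compared by monotonicity.\<close>

lemma pg_points_eq: "pg_points k = linear_set (coord_space k :: (nat \<Rightarrow> 'a::field) set)"
proof (intro equalityI subsetI)
  fix P :: "(nat \<Rightarrow> 'a) set" assume P: "P \<in> pg_points k"
  then have sub: "ext.subspace P" and PV: "P \<subseteq> coord_space k" and dim: "ext.dim P = 1"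
    by (auto simp: pg_points_def)
  obtain B where B: "B \<subseteq> P" "ext.independent B" "P \<subseteq> ext.span B" "card B = 1"
    using ext.basis_exists[of P] dim by auto
  then obtain v where v: "B = {v}" by (auto simp: card_1_singleton_iff)
  have "ext.span B \<subseteq> P" by (rule ext.span_minimal[OF B(1) sub])
  then have "P = ext.span {v}" using B v by blast
  moreover have "v \<in> coord_space k - {0}" using B PV v by auto
  ultimately show "P \<in> linear_set (coord_space k)" unfolding linear_set_def by blast
next
  fix P :: "(nat \<Rightarrow> 'a) set" assume "P \<in> linear_set (coord_space k)"
  then obtain v where v: "P = ext.span {v}" "v \<in> coord_space k" "v \<noteq> 0"
    unfolding linear_set_def by blast
  have "ext.dim P = 1"
    using v ext.dim_eq_card_independent[of "{v}"] by simp
  moreover have "P \<subseteq> coord_space k"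
    unfolding v(1) by (rule ext.span_minimal) (use v ext_subspace_coord_space in auto)
  ultimately show "P \<in> pg_points k" by (simp add: pg_points_def v(1))
qed

lemma linear_set_mono: "U \<subseteq> V \<Longrightarrow> linear_set U \<subseteq> linear_set V"
  unfolding linear_set_def by blast

lemma combination_of_iff_saturated:
  assumes "v \<noteq> 0"
  shows "saturated r (linear_set U) (ext.span {v}) \<longleftrightarrow> combination_of r U v"
proof
  assume "saturated r (linear_set U) (ext.span {v})"
  then obtain P where P: "\<And>i. i < r \<Longrightarrow> P i \<in> linear_set U"
      "ext.span {v} \<subseteq> ext.span (\<Union>i<r. P i)"
    unfolding saturated_def by blast
  have "\<forall>i. \<exists>u. i < r \<longrightarrow> u \<in> U \<and> P i = ext.span {u}"
    using P(1) unfolding linear_set_def by blast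
  then obtain u where u: "\<And>i. i < r \<Longrightarrow> u i \<in> U \<and> P i = ext.span {u i}" by metis
  then have "(\<Union>i<r. P i) = (\<Union>i<r. ext.span {u i})" by auto
  moreover have "v \<in> ext.span {v}" by (simp add: ext.span_base)
  ultimately have "v \<in> ext.span (\<Union>i<r. ext.span {u i})" using P(2) by auto
  then show "combination_of r U v"
    unfolding ext_span_points combination_of_def using u by blast
next
  assume "combination_of r U v"
  then obtain c u where u: "\<And>i. i < r \<Longrightarrow> u i \<in> U" and v: "v = (\<lambda>n. \<Sum>i<r. c i * u i n)"
    unfolding combination_of_def by blast
  \<comment> \<open>Zero vectors yield no point of the linear set. Since
    \<open>v \<noteq> 0\<close>, some \<open>u j\<close> is nonzero; it replaces each of them, with
    coefficient 0.\<close>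
  have "\<exists>j<r. u j \<noteq> 0"
  proof (rule ccontr)
    assume "\<not> (\<exists>j<r. u j \<noteq> 0)"
    then have "v = 0" unfolding v by (simp add: fun_eq_iff)
    then show False using assms by simp
  qed
  then obtain j where j: "j < r" "u j \<noteq> 0" by blast
  define u' where "u' i = (if u i = 0 then u j else u i)" for i
  define c' where "c' i = (if u i = 0 then 0 else c i)" for i
  have "v = (\<lambda>n. \<Sum>i<r. c' i * u' i n)"
    unfolding v by (intro ext sum.cong) (auto simp: c'_def u'_def)
  then have "v \<in> ext.span (\<Union>i<r. ext.span {u' i})" unfolding ext_span_points by blast
  then have "ext.span {v} \<subseteq> ext.span (\<Union>i<r. ext.span {u' i})"
    by (intro ext.span_minimal) auto
  moreover have "ext.span {u' i} \<in> linear_set U" if "i < r" for i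
    unfolding linear_set_def using u[OF that] u[OF j(1)] j(2) by (auto simp: u'_def)
  ultimately show "saturated r (linear_set U) (ext.span {v})"
    unfolding saturated_def by (intro exI[of _ "\<lambda>i. ext.span {u' i}"]) simp
qed

lemma saturates_all_iff:
  assumes "0 \<in> U"
  shows "saturates_all k r (linear_set U) \<longleftrightarrow> (\<forall>v\<in>coord_space k. combination_of r U v)"
proof -
  \<comment> \<open>The zero vector spans no point, so the saturation property says nothing about
    it; it is a trivial combination because \<open>0 \<in> U\<close>.\<close>
  have "combination_of r U 0"
    unfolding combination_of_def using assms
    by (intro exI[of _ "\<lambda>_. 0"] exI[of _ "\<lambda>_. 0"]) (auto simp: fun_eq_iff)
  moreover have "saturates_all k r (linear_set U) \<longleftrightarrow>
      (\<forall>v\<in>coord_space k - {0}. saturated r (linear_set U) (ext.span {v}))"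
    unfolding saturates_all_def pg_points_eq unfolding linear_set_def by blast
  ultimately show ?thesis
    using combination_of_iff_saturated by (metis Diff_iff singletonD singletonI)
qed

section \<open>Counting the vectors of the coordinate space\<close>

lemma coord_space_eq_image:
  "(coord_space k :: (nat \<Rightarrow> 'a::field) set) = (\<lambda>f n. if n < k then f n else 0) ` ({..<k} \<rightarrow>\<^sub>E UNIV)"
proof (intro equalityI subsetI)
  fix v :: "nat \<Rightarrow> 'a" assume "v \<in> coord_space k"
  then have "v = (\<lambda>n. if n < k then restrict v {..<k} n else 0)"
    by (auto simp: coord_space_def fun_eq_iff)
  then show "v \<in> (\<lambda>f n. if n < k then f n else 0) ` ({..<k} \<rightarrow>\<^sub>E UNIV)"
    by (rule image_eqI[of _ _ "restrict v {..<k}"]) simp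
qed (elim imageE, simp add: coord_space_def)

lemma finite_coord_space: "finite (coord_space k :: (nat \<Rightarrow> 'e::{field,finite}) set)"
  unfolding coord_space_eq_image by (intro finite_imageI finite_PiE) auto

lemma card_coord_space: "card (coord_space k :: (nat \<Rightarrow> 'e::{field,finite}) set) = CARD('e) ^ k"
proof -
  have "inj_on (\<lambda>f n. if n < k then f n else (0 :: 'e)) ({..<k} \<rightarrow>\<^sub>E UNIV)"
  proof (rule inj_onI)
    fix f g :: "nat \<Rightarrow> 'e"
    assume fg: "f \<in> {..<k} \<rightarrow>\<^sub>E UNIV" "g \<in> {..<k} \<rightarrow>\<^sub>E UNIV"
      and eq: "(\<lambda>n. if n < k then f n else 0) = (\<lambda>n. if n < k then g n else 0)"
    have "f n = g n" if "n < k" for n using fun_cong[OF eq, of n] that by simp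
    then show "f = g" using fg by (intro PiE_ext[of _ "{..<k}"]) auto
  qed
  from card_image[OF this] show ?thesis
    by (simp only: coord_space_eq_image) (simp add: card_PiE)
qed

section \<open>Subspaces over the base field and change of coefficients\<close>

context finite_field_extension
begin

sublocale base: vector_space "scale_base emb"
  by (rule vector_space_scale_base[OF field_embedding])

lemma card_base_subspace:
  assumes "base.subspace U" "finite U"
  shows "card U = CARD('f) ^ base.dim U"
proof -
  obtain B where B: "B \<subseteq> U" "base.independent B" "U \<subseteq> base.span B" "card B = base.dim U"
    using base.basis_exists[of U] by auto
  have "base.span B \<subseteq> U" by (rule base.span_minimal[OF B(1) assms(1)])
  then have "U = base.span B" using B by blast
  then show ?thesis
    using base.card_span_eq[of B] B assms(2) finite_subset[OF B(1)] by metis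
qed

lemma base_subspace_lincomb:
  assumes "base.subspace U" "\<And>i. i < p \<Longrightarrow> w i \<in> U"
  shows "(\<lambda>n. \<Sum>i<p. emb (c i) * w i n) \<in> U"
proof -
  have "(\<Sum>i<p. scale_base emb (c i) (w i)) \<in> U"
    using assms by (intro base.subspace_sum base.subspace_scale) auto
  also have "(\<Sum>i<p. scale_base emb (c i) (w i)) = (\<lambda>n. \<Sum>i<p. emb (c i) * w i n)"
    by (simp add: fun_eq_iff sum_fun_apply scale_base_def scale_ext_def)
  finally show ?thesis .
qed

text \<open>Expanding each \<open>c i\<close> in the \<open>l j\<close> and exchanging the sums
  moves the base field scalars onto the vectors. The new vectors are base field combinations of the
  \<open>u i\<close> and hence stay in \<open>U\<close>.\<close>

lemma combination_of_change_coefficients: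
  assumes "base.subspace U" "\<And>i. i < r \<Longrightarrow> c i \<in> base_span r l" "\<And>i. i < r \<Longrightarrow> u i \<in> U"
  shows "\<exists>w\<in>{..<r} \<rightarrow>\<^sub>E U. (\<lambda>n. \<Sum>i<r. c i * u i n) = (\<lambda>n. \<Sum>i<r. l i * w i n)"
proof -
  have "\<forall>i. \<exists>d. i < r \<longrightarrow> c i = (\<Sum>j<r. emb (d j) * l j)"
    using assms(2) unfolding base_span_def by blast
  then obtain d where d: "\<And>i. i < r \<Longrightarrow> c i = (\<Sum>j<r. emb (d i j) * l j)" by metis
  define w where "w = restrict (\<lambda>j n. \<Sum>i<r. emb (d i j) * u i n) {..<r}"
  have "w \<in> {..<r} \<rightarrow>\<^sub>E U"
    unfolding w_def using base_subspace_lincomb[OF assms(1,3)] by auto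
  moreover have "(\<Sum>i<r. c i * u i n) = (\<Sum>j<r. l j * w j n)" for n
  proof -
    have "(\<Sum>i<r. c i * u i n) = (\<Sum>i<r. \<Sum>j<r. emb (d i j) * l j * u i n)"
      by (simp add: d sum_distrib_right)
    also have "\<dots> = (\<Sum>j<r. \<Sum>i<r. emb (d i j) * l j * u i n)" by (rule sum.swap)
    also have "\<dots> = (\<Sum>j<r. l j * w j n)"
      by (simp add: w_def sum_distrib_left mult_ac)
    finally show ?thesis .
  qed
  ultimately show ?thesis by blast
qed

section \<open>The lower bound\<close>

text \<open>
  Each vector is counted once for every ordered basis of an $r$-dimensional subspace of the
  extension field that contains the coefficients of some representation of this vector.
\<close>

lemma card_combinations_ge:
  assumes "CARD('e) = CARD('f) ^ m" "1 \<le> r" "r \<le> m" "base.subspace U" "finite U"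
    and "combination_of r U v"
  shows "CARD('f) ^ ((r - 1) * r) \<le> card {(l, w). l \<in> {..<r} \<rightarrow>\<^sub>E UNIV \<and> l \<noteq> restrict (\<lambda>_. 0) {..<r} \<and>
           w \<in> {..<r} \<rightarrow>\<^sub>E U \<and> v = (\<lambda>n. \<Sum>i<r. l i * w i n)}"
    (is "_ \<le> card ?S")
proof -
  obtain c u where u: "\<And>i. i < r \<Longrightarrow> u i \<in> U" and v: "v = (\<lambda>n. \<Sum>i<r. c i * u i n)"
    using assms(6) unfolding combination_of_def by blast
  obtain l where l: "base_independent r l" "\<forall>i<r. c i \<in> base_span r l"
    using exists_base_independent_spanning[OF assms(1,3)] by blast
  let ?A = "{l' \<in> {..<r} \<rightarrow>\<^sub>E base_span r l. base_independent r l'}"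
  \<comment> \<open>Different bases are different first components, so one \<open>w\<close> for each
    basis suffices for the count.\<close>
  have "?A \<subseteq> fst ` ?S"
  proof
    fix l' assume l': "l' \<in> ?A"
    \<comment> \<open>An independent \<open>r\<close>-tuple inside the span of \<open>l\<close>
      spans equally many elements, hence all of it.\<close>
    have "base_span r l' = base_span r l"
    proof (rule card_subset_eq)
      show "base_span r l' \<subseteq> base_span r l" by (rule base_span_mono) (use l' in auto)
      show "card (base_span r l') = card (base_span r l)"
        using l' l card_base_span_eq by simp
    qed simp
    then have "\<exists>w\<in>{..<r} \<rightarrow>\<^sub>E U. v = (\<lambda>n. \<Sum>i<r. l' i * w i n)"
      unfolding v using l(2) u by (intro combination_of_change_coefficients assms(4)) auto
    then obtain w where w: "w \<in> {..<r} \<rightarrow>\<^sub>E U" "v = (\<lambda>n. \<Sum>i<r. l' i * w i n)" by blast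
    have "l' \<noteq> restrict (\<lambda>_. 0) {..<r}"
    proof
      assume "l' = restrict (\<lambda>_. 0) {..<r}"
      then have "(\<Sum>i<r. emb 1 * l' i) = 0" by simp
      then show False using base_independentD[of r l' "\<lambda>_. 1" 0] l' assms(2) by simp
    qed
    moreover have "l' \<in> {..<r} \<rightarrow>\<^sub>E UNIV" using l' by (simp add: PiE_def)
    ultimately have "(l', w) \<in> ?S" using w by simp
    then show "l' \<in> fst ` ?S" by (rule image_eqI[rotated]) simp
  qed
  moreover have fin: "finite ?S"
    by (rule finite_subset[of _ "({..<r} \<rightarrow>\<^sub>E UNIV) \<times> ({..<r} \<rightarrow>\<^sub>E U)"])
      (use assms(5) in \<open>simp_all add: finite_PiE subset_iff\<close>)
  ultimately have "card ?A \<le> card ?S"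
    by (intro order_trans[OF card_mono card_image_le] finite_imageI)
  moreover have "CARD('f) ^ ((r - 1) * r) \<le> card ?A"
    by (rule card_base_independent_ge) (simp_all add: card_base_span_eq l(1))
  ultimately show ?thesis by linarith
qed

lemma saturating_dim_ge:
  assumes "CARD('e) = CARD('f) ^ m" "1 \<le> r" "r \<le> m" "1 \<le> t" "base.subspace U" "finite U"
    and "\<And>v. v \<in> coord_space (r * t) \<Longrightarrow> combination_of r U v"
  shows "m * (t - 1) + r \<le> base.dim U"
proof -
  let ?q = "CARD('f)" and ?d = "base.dim U"
  let ?Z = "restrict (\<lambda>_. 0 :: 'e) {..<r}"
  let ?L = "({..<r} \<rightarrow>\<^sub>E (UNIV :: 'e set)) - {?Z}" and ?W = "{..<r} \<rightarrow>\<^sub>E U"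
  let ?S = "\<lambda>v. {(l, w). l \<in> {..<r} \<rightarrow>\<^sub>E UNIV \<and> l \<noteq> ?Z \<and> w \<in> ?W \<and> v = (\<lambda>n. \<Sum>i<r. l i * w i n)}"
  have fin: "finite (?L \<times> ?W)" using assms(6) by (auto simp: finite_PiE)
  have sub: "?S v \<subseteq> ?L \<times> ?W" for v by auto
  have U: "card U = ?q ^ ?d" using assms(5,6) by (rule card_base_subspace)
  have "?q ^ (m * (r * t) + (r - 1) * r) = (\<Sum>v\<in>(coord_space (r * t) :: (nat \<Rightarrow> 'e) set). ?q ^ ((r - 1) * r))"
    by (simp add: card_coord_space assms(1) power_add power_mult)
  also have "\<dots> \<le> (\<Sum>v\<in>coord_space (r * t). card (?S v))"
    by (rule sum_mono) (rule card_combinations_ge[OF assms(1-3,5,6) assms(7)])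
  \<comment> \<open>A pair determines the vector it represents, so these sets are disjoint.\<close>
  also have "\<dots> = card (\<Union>v\<in>coord_space (r * t). ?S v)"
    by (rule card_UN_disjoint[symmetric])
      (use finite_coord_space finite_subset[OF sub fin] in auto)
  also have "\<dots> \<le> card (?L \<times> ?W)"
    by (rule card_mono[OF fin]) (use sub in blast)
  also have "\<dots> = card ?L * card ?W" by (rule card_cartesian_product)
  \<comment> \<open>The excluded zero tuple makes the inequality strict. In the exponents, after
    cancelling \<open>r\<close>, this gives \<open>m * t + (r - 1) < m + ?d\<close>; a weak
    inequality would yield a bound smaller by one.\<close>
  also have "\<dots> < card ({..<r} \<rightarrow>\<^sub>E (UNIV :: 'e set)) * card ?W"
  proof (rule mult_strict_right_mono)
    show "card ?L < card ({..<r} \<rightarrow>\<^sub>E (UNIV :: 'e set))"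
      by (rule card_Diff1_less) (simp_all add: finite_PiE)
    show "0 < card ?W" using U card_base_ge_2 by (simp add: card_PiE)
  qed
  also have "\<dots> = ?q ^ (m * r + ?d * r)"
    by (simp add: card_PiE U assms(1) power_add power_mult)
  finally have "m * (r * t) + (r - 1) * r < m * r + ?d * r"
    by (rule power_less_imp_less_exp[rotated]) (use card_base_ge_2 in simp)
  then have "(m * t + (r - 1)) * r < (m + ?d) * r"
    by (simp add: algebra_simps)
  then have "m * t + (r - 1) < m + ?d" unfolding mult_less_cancel2 by (rule conjunct2)
  moreover have "m * t = m * (t - 1) + m"
    using assms(4) by (cases t) auto
  ultimately show ?thesis using assms(2) by linarith
qed

section \<open>The Frobenius system\<close>

definition frobenius_vector :: "nat \<Rightarrow> nat \<Rightarrow> (nat \<Rightarrow> 'e) \<Rightarrow> (nat \<Rightarrow> 'f) \<Rightarrow> nat \<Rightarrow> 'e" where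
  "frobenius_vector r t x a =
     (\<lambda>n. if n < r * (t - 1) then x (n div r) ^ (CARD('f) ^ (n mod r))
          else if n < r * t then emb (a (n mod r)) else 0)"

lemma frobenius_system_eq:
  "frobenius_system emb r t = {frobenius_vector r t x a | x a. True}"
  by (simp only: frobenius_system_def frobenius_vector_def)

lemma frobenius_vector_block:
  assumes "b < t - 1" "j < r"
  shows "frobenius_vector r t x a (r * b + j) = x b ^ (CARD('f) ^ j)"
proof -
  have "r * b + j < r * Suc b" using assms(2) by simp
  also have "\<dots> \<le> r * (t - 1)" using assms(1) by (intro mult_le_mono2) simp
  finally show ?thesis using assms(2) by (simp add: frobenius_vector_def)
qed

lemma frobenius_vector_last:
  assumes "1 \<le> t" "j < r"
  shows "frobenius_vector r t x a (r * (t - 1) + j) = emb (a j)"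
proof -
  have "r * (t - 1) + j < r * t" using assms by (cases t) auto
  then show ?thesis using assms(2) by (simp add: frobenius_vector_def)
qed

lemma block_cases:
  fixes n r t :: nat
  assumes "n < r * t"
  obtains b j where "n = r * b + j" "b < t - 1" "j < r"
    | j where "n = r * (t - 1) + j" "j < r" "1 \<le> t"
proof -
  have r: "0 < r" "1 \<le> t" using assms by (cases r; cases t; simp)+
  have n: "n = r * (n div r) + n mod r" "n mod r < r" using r by auto
  have "n div r < t" using assms r by (simp add: less_mult_imp_div_less mult.commute)
  then consider "n div r < t - 1" | "n div r = t - 1" by linarith
  then show ?thesis using that n r by cases metis+
qed

lemma frobenius_system_subset: "frobenius_system emb r t \<subseteq> coord_space (r * t)"
proof -
  have "frobenius_vector r t x a n = 0" if "n \<ge> r * t" for x a n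
  proof -
    have "r * (t - 1) \<le> r * t" by simp
    then have "\<not> n < r * (t - 1)" "\<not> n < r * t" using that by linarith+
    then show ?thesis by (simp only: frobenius_vector_def if_False)
  qed
  then show ?thesis by (auto simp: frobenius_system_eq coord_space_def)
qed

lemma frobenius_system_subspace: "base.subspace (frobenius_system emb r t)"
proof (rule base.subspaceI)
  have "0 = frobenius_vector r t (\<lambda>_. 0) (\<lambda>_. 0)"
    by (simp add: frobenius_vector_def fun_eq_iff power_0_left)
  then show "0 \<in> frobenius_system emb r t" unfolding frobenius_system_eq by blast
next
  fix u v assume "u \<in> frobenius_system emb r t" "v \<in> frobenius_system emb r t"
  then obtain x a y b where "u = frobenius_vector r t x a" "v = frobenius_vector r t y b"
    unfolding frobenius_system_eq by blast
  then have "u + v = frobenius_vector r t (\<lambda>i. x i + y i) (\<lambda>i. a i + b i)"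
    by (simp add: frobenius_vector_def fun_eq_iff frobenius_add)
  then show "u + v \<in> frobenius_system emb r t" unfolding frobenius_system_eq by blast
next
  fix c v assume "v \<in> frobenius_system emb r t"
  then obtain x a where "v = frobenius_vector r t x a"
    unfolding frobenius_system_eq by blast
  then have "scale_base emb c v = frobenius_vector r t (\<lambda>i. emb c * x i) (\<lambda>i. c * a i)"
    by (simp add: frobenius_vector_def fun_eq_iff power_mult_distrib scale_base_def scale_ext_def)
  then show "scale_base emb c v \<in> frobenius_system emb r t" unfolding frobenius_system_eq by blast
qed

text \<open>The vector depends only on the values of \<open>x\<close> below \<open>t - 1\<close> and
  of \<open>a\<close> below \<open>r\<close>, and these can be read off from it.\<close>

lemma card_frobenius_system:
  assumes "1 \<le> r" "1 \<le> t"
  shows "card (frobenius_system emb r t) = CARD('e) ^ (t - 1) * CARD('f) ^ r"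
proof -
  let ?D = "({..<t - 1} \<rightarrow>\<^sub>E (UNIV :: 'e set)) \<times> ({..<r} \<rightarrow>\<^sub>E (UNIV :: 'f set))"
  let ?f = "\<lambda>(x, a). frobenius_vector r t x a"
  have "frobenius_vector r t x a \<in> ?f ` ?D" for x a
  proof (rule image_eqI)
    have "n div r < t - 1" if "n < r * (t - 1)" for n
      using that by (simp add: less_mult_imp_div_less mult.commute)
    then show "frobenius_vector r t x a = ?f (restrict x {..<t - 1}, restrict a {..<r})"
      using assms by (auto simp: frobenius_vector_def fun_eq_iff)
  qed simp
  then have "frobenius_system emb r t \<subseteq> ?f ` ?D"
    unfolding frobenius_system_eq by (auto simp only: mem_Collect_eq)
  then have "frobenius_system emb r t = ?f ` ?D"
    by (rule equalityI) (auto simp: frobenius_system_eq)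
  moreover have "inj_on ?f ?D"
  proof (rule inj_onI)
    fix s s' assume s: "s \<in> ?D" "s' \<in> ?D" "?f s = ?f s'"
    obtain x a y b where ss: "s = (x, a)" "s' = (y, b)" by (cases s, cases s')
    have eq: "frobenius_vector r t x a n = frobenius_vector r t y b n" for n
      using s(3) by (simp add: ss)
    \<comment> \<open>Position 0 of a block has exponent q^0 = 1 and shows the parameter
      itself.\<close>
    have "x i = y i" if "i < t - 1" for i
      using eq[of "r * i + 0"] that assms by (simp only: frobenius_vector_block) simp
    then have "x = y" using s by (intro PiE_ext[of _ "{..<t - 1}"]) (auto simp: ss)
    moreover have "a j = b j" if "j < r" for j
      using eq[of "r * (t - 1) + j"] that assms by (simp only: frobenius_vector_last emb_eq_iff)
    then have "a = b" using s by (intro PiE_ext[of _ "{..<r}"]) (auto simp: ss)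
    ultimately show "s = s'" by (simp add: ss)
  qed
  ultimately show ?thesis by (simp add: card_image card_PiE card_cartesian_product)
qed

lemma frobenius_system_covers:
  assumes "CARD('e) = CARD('f) ^ m" "r \<le> m" "1 \<le> t" "v \<in> coord_space (r * t)"
  shows "combination_of r (frobenius_system emb r t) v"
proof -
  \<comment> \<open>The last block dictates the coefficients: its entries must be base field
    combinations of them. So \<open>l\<close> is chosen first.\<close>
  obtain l where l: "base_independent r l" "\<forall>j<r. v (r * (t - 1) + j) \<in> base_span r l"
    using exists_base_independent_spanning[OF assms(1,2), of "\<lambda>j. v (r * (t - 1) + j)"] by blast
  have "\<forall>j. \<exists>a. j < r \<longrightarrow> v (r * (t - 1) + j) = (\<Sum>i<r. emb (a i) * l i)"
    using l(2) unfolding base_span_def by blast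
  then obtain a where a: "\<And>j. j < r \<Longrightarrow> v (r * (t - 1) + j) = (\<Sum>i<r. emb (a j i) * l i)" by metis
  \<comment> \<open>With \<open>l\<close> fixed, the blocks decouple into one solvable system each;
    the unknown \<open>x b i\<close> becomes the parameter of block \<open>b\<close> in the
    \<open>i\<close>-th vector.\<close>
  have "\<forall>b. \<exists>x. \<forall>j<r. (\<Sum>i<r. l i * x i ^ (CARD('f) ^ j)) = v (r * b + j)"
    by (intro allI frobenius_system_solvable l(1))
  then obtain x where x: "\<And>b j. j < r \<Longrightarrow> (\<Sum>i<r. l i * x b i ^ (CARD('f) ^ j)) = v (r * b + j)" by metis
  define u where "u i = frobenius_vector r t (\<lambda>b. x b i) (\<lambda>j. a j i)" for i
  have "v n = (\<Sum>i<r. l i * u i n)" for n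
  proof (cases "n < r * t")
    case True
    then show ?thesis
    proof (cases rule: block_cases)
      case (1 b j)
      then show ?thesis using x[of j b] by (simp add: u_def frobenius_vector_block)
    next
      case (2 j)
      then show ?thesis using a[of j]
        by (simp only: u_def frobenius_vector_last) (simp add: mult.commute)
    qed
  next
    case False
    moreover have "u i \<in> coord_space (r * t)" for i
      using frobenius_system_subset unfolding frobenius_system_eq u_def by blast
    ultimately have "u i n = 0" for i by (simp add: coord_space_def)
    then show ?thesis using assms(4) False by (simp add: coord_space_def)
  qed
  then have "v = (\<lambda>n. \<Sum>i<r. l i * u i n)" by (rule ext)
  moreover have "u i \<in> frobenius_system emb r t" for i
    unfolding frobenius_system_eq u_def by blast
  ultimately show ?thesis unfolding combination_of_def by blast
qed

text \<open>Vectors of the system have base field entries in the last block. A combination of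
  \<open>p\<close> of them therefore has its last block in the base field span of the
  \<open>p\<close> coefficients, which has at most q^p elements and cannot contain
  \<open>r > p\<close> independent ones.\<close>

lemma frobenius_system_not_covers:
  assumes "CARD('e) = CARD('f) ^ m" "r \<le> m" "1 \<le> t" "p < r"
  shows "\<exists>v\<in>coord_space (r * t). \<not> combination_of p (frobenius_system emb r t) v"
proof -
  obtain l where l: "base_independent r l"
    using exists_base_independent_spanning[OF assms(1,2)] by blast
  define v where "v n = (if r * (t - 1) \<le> n \<and> n < r * t then l (n - r * (t - 1)) else 0)" for n
  have "v \<in> coord_space (r * t)" by (simp add: v_def coord_space_def)
  moreover have "\<not> combination_of p (frobenius_system emb r t) v"
  proof
    assume "combination_of p (frobenius_system emb r t) v"
    then obtain c u where u: "\<forall>i<p. u i \<in> frobenius_system emb r t"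
      and v: "v = (\<lambda>n. \<Sum>i<p. c i * u i n)" unfolding combination_of_def by blast
    have "\<forall>i. \<exists>x a. i < p \<longrightarrow> u i = frobenius_vector r t x a"
      using u unfolding frobenius_system_eq by blast
    then obtain x a where xa: "\<And>i. i < p \<Longrightarrow> u i = frobenius_vector r t (x i) (a i)" by metis
    have "l j \<in> base_span p c" if j: "j < r" for j
    proof -
      have "r * (t - 1) + j < r * t" using assms(3) j by (cases t) auto
      then have "l j = v (r * (t - 1) + j)" by (simp add: v_def)
      also have "\<dots> = (\<Sum>i<p. c i * u i (r * (t - 1) + j))" by (simp only: v)
      also have "\<dots> = (\<Sum>i<p. emb (a i j) * c i)"
        by (rule sum.cong) (simp_all only: lessThan_iff xa frobenius_vector_last[OF assms(3) j] mult.commute)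
      finally show ?thesis unfolding base_span_def by (rule range_eqI[of _ _ "\<lambda>i. a i j"])
    qed
    then have "base_span r l \<subseteq> base_span p c" by (rule base_span_mono)
    then have "card (base_span r l) \<le> card (base_span p c)" by (intro card_mono) auto
    then have "CARD('f) ^ r \<le> CARD('f) ^ p"
      using card_base_span_eq[OF l] card_base_span_le[of p c] by simp
    then have "r \<le> p" using card_base_ge_2 by (simp add: power_le_imp_le_exp)
    then show False using assms(4) by simp
  qed
  ultimately show ?thesis by blast
qed

end

section \<open>The Frobenius system is saturating and attains the lower bound\<close>

theorem theorem2p1:
  fixes emb :: "'f::{field,finite} \<Rightarrow> 'e::{field,finite}"
    and q m \<rho> t k :: nat
  assumes "field_embedding emb"
    and "CARD('f) = q"
    and "CARD('e) = q ^ m"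
    and "m \<ge> 2"
    and "\<rho> \<ge> 1"
    and "t \<ge> 1"
    and "\<rho> \<le> m"
    and "k = \<rho> * t"
  shows "saturating_system emb k \<rho> (frobenius_system emb \<rho> t) \<and>
         min_saturating_dim emb k \<rho> = m * (t - 1) + \<rho>"
proof
  interpret finite_field_extension emb using assms(1) by unfold_locales
  have card: "CARD('e) = CARD('f) ^ m" using assms(2,3) by simp
  let ?F = "frobenius_system emb \<rho> t"
  have finite: "finite ?F"
    by (rule finite_subset[OF frobenius_system_subset finite_coord_space])
  \<comment> \<open>Keeping \<open>r\<close> general serves both saturation at \<open>\<rho>\<close>
    and its failure for all smaller values.\<close>
  have all: "saturates_all k r (linear_set ?F) \<longleftrightarrow> (\<forall>v\<in>coord_space k. combination_of r ?F v)" for r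
    by (rule saturates_all_iff) (rule base.subspace_0[OF frobenius_system_subspace])
  have "linear_set ?F \<subseteq> pg_points k"
    unfolding pg_points_eq assms(8) by (rule linear_set_mono[OF frobenius_system_subset])
  moreover have "saturates_all k \<rho> (linear_set ?F)"
    unfolding all unfolding assms(8) using frobenius_system_covers[OF card assms(7,6)] by blast
  moreover have "\<forall>r<\<rho>. \<not> saturates_all k r (linear_set ?F)"
    unfolding all unfolding assms(8) using frobenius_system_not_covers[OF card assms(7,6)] by blast
  ultimately show sys: "saturating_system emb k \<rho> ?F"
    using frobenius_system_subset frobenius_system_subspace
    by (simp add: saturating_system_def saturating_set_def assms(8))
  \<comment> \<open>The dimension is recovered from the cardinality, since powers of q \<ge> 2
    determine their exponents.\<close>
  have "CARD('f) ^ base.dim ?F = CARD('f) ^ (m * (t - 1) + \<rho>)"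
    using card_base_subspace[OF frobenius_system_subspace finite] card_frobenius_system[OF assms(5,6)]
    by (simp add: card power_add power_mult)
  then have dim: "base.dim ?F = m * (t - 1) + \<rho>"
    using card_base_ge_2 by (simp add: power_inject_exp)
  show "min_saturating_dim emb k \<rho> = m * (t - 1) + \<rho>"
    unfolding min_saturating_dim_def
  proof (rule Least_equality)
    show "\<exists>U. saturating_system emb k \<rho> U \<and> base.dim U = m * (t - 1) + \<rho>" using sys dim by blast
  next
    fix d assume "\<exists>U. saturating_system emb k \<rho> U \<and> base.dim U = d"
    then obtain U where U: "saturating_system emb k \<rho> U" "base.dim U = d" by blast
    then have sub: "base.subspace U" and UV: "U \<subseteq> coord_space k"
      and sat: "saturates_all k \<rho> (linear_set U)"
      by (simp_all add: saturating_system_def saturating_set_def)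
    have "finite U" by (rule finite_subset[OF UV finite_coord_space])
    moreover have "combination_of \<rho> U v" if "v \<in> coord_space (\<rho> * t)" for v
      using sat saturates_all_iff[OF base.subspace_0[OF sub]] that assms(8) by blast
    ultimately show "m * (t - 1) + \<rho> \<le> d"
      using saturating_dim_ge[OF card assms(5,7,6) sub] U(2) by blast
  qed
qed

end
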